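(* Let $(X,V,W,S,\mathcal H_*,h,*,\Theta)$ satisfy the abstract symmetrization framework described in the context. Let $F:X\to X$ be a map such that $$\|F(u)-u\|\le f(u)-f(F(u))\qquad\text{for all }u\in X,$$ where $f:X\to\mathbb R$ is a lower semi-continuous function, bounded from below, satisfying $f(u^H)\le f(u)$ for all $u\in S$ and $H\in\mathcal H_*$, and such that for all $u\in X$ there exists $\xi\in S$ with $f(\xi)\le f(u)$. Then, for all $\varepsilon\in(0,1)$, there exists a fixed point $\xi_\varepsilon\in X$ of $F$ such that $\|\xi_\varepsilon-\xi_\varepsilon^*\|_V<\varepsilon$.
   Context: Abstract framework. $X,V,W$ are real Banach spaces with $X\subseteq V\subseteq W$, $X$ continuously embedded in $V$ and $V$ continuously embedded in $W$; $\|\cdot\|$ is the norm of $X$. $S\subseteq X$ carries the metric induced by $\|\cdot\|$, $\mathcal H_*$ is a path-connected topological space, and there are maps $*:S\to S$, $u\mapsto u^*$ (symmetrization) and $h:S\times\mathcal H_*\to S$, $(u,H)\mapsto u^H$ (polarization) such that: $h$ is continuous; $(u^* )^H=(u^H)^*=u^*$ and $(u^H)^H=u^H$ for all $u\in S$, $H\in\mathcal H_*$; there is a sequence $(H_m)\subset\mathcal H_*$ such that for every $u\in S$ the iterated polarizations $u^{H_1\cdots H_m}$ converge to $u^*$ in $V$ as $m\to\infty$; $\|u^H-v^H\|_V\le\|u-v\|_V$ for all $u,v\in S$, $H\in\mathcal H_*$. Moreover $\Theta:(X,\|\cdot\|_V)\to(S,\|\cdot\|_V)$ is Lipschitz with constant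 $C_\Theta>0$ and $\Theta|_S=\mathrm{Id}|_S$; for $u\in X$ one sets $u^H:=(\Theta(u))^H$ and $u^*:=(\Theta(u))^*$. *)

theory Defs
  imports "HOL-Analysis.Analysis"
begin

(* The inclusions of X in V and of V in W are injective bounded linear maps i and j between
   Banach space types, so the V-norm of an element u of X is norm (i u). The space of polarizers is
   the carrier of a topology \<H>, and h u H is the polarization of u. *)
locale symmetrization_framework =
  fixes i :: "'x::banach \<Rightarrow> 'v::banach"
    and j :: "'v \<Rightarrow> 'w::banach"
    and S :: "'x set"
    and \<H> :: "'h topology"
    and h :: "'x \<Rightarrow> 'h \<Rightarrow> 'x"
    and star :: "'x \<Rightarrow> 'x"
    and \<Theta> :: "'x \<Rightarrow> 'x"
  assumes embedding_X_V: "bounded_linear i" "inj i"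
    and embedding_V_W: "bounded_linear j" "inj j"
    and path_connected: "path_connected_space \<H>"
    and star_into: "star \<in> S \<rightarrow> S"
    and polarization_continuous:
      "continuous_map (prod_topology (top_of_set S) \<H>) (top_of_set S) (\<lambda>(u, H). h u H)"
    and polarization_star: "\<And>u H. u \<in> S \<Longrightarrow> H \<in> topspace \<H> \<Longrightarrow> h (star u) H = star u"
    and star_polarization: "\<And>u H. u \<in> S \<Longrightarrow> H \<in> topspace \<H> \<Longrightarrow> star (h u H) = star u"
    and polarization_idem: "\<And>u H. u \<in> S \<Longrightarrow> H \<in> topspace \<H> \<Longrightarrow> h (h u H) H = h u H"
    (* the sequence is indexed from 0; the polarizer at index 0 is applied first *)
    and approximation:
      "\<exists>Hs :: nat \<Rightarrow> 'h. (\<forall>m. Hs m \<in> topspace \<H>) \<and>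
         (\<forall>u\<in>S. (\<lambda>m. i (foldl h u (map Hs [0..<m]))) \<longlonglongrightarrow> i (star u))"
    and polarization_contractive:
      "\<And>u v H. u \<in> S \<Longrightarrow> v \<in> S \<Longrightarrow> H \<in> topspace \<H> \<Longrightarrow>
         norm (i (h u H) - i (h v H)) \<le> norm (i u - i v)"
    and \<Theta>_into: "\<Theta> \<in> UNIV \<rightarrow> S"
    and \<Theta>_lipschitz: "\<exists>C>0. \<forall>u v. norm (i (\<Theta> u) - i (\<Theta> v)) \<le> C * norm (i u - i v)"
    and \<Theta>_on_S: "\<And>u. u \<in> S \<Longrightarrow> \<Theta> u = u"

(* The symmetrization of an arbitrary element of X. *)
definition extended_star :: "('x \<Rightarrow> 'x) \<Rightarrow> ('x \<Rightarrow> 'x) \<Rightarrow> 'x \<Rightarrow> 'x" where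
  "extended_star star \<Theta> u = star (\<Theta> u)"

definition lower_semicontinuous :: "('a::topological_space \<Rightarrow> real) \<Rightarrow> bool" where
  "lower_semicontinuous f \<longleftrightarrow> (\<forall>x. \<forall>a<f x. \<forall>\<^sub>F y in nhds x. a < f y)"

end

theory Submission
  imports Defs
begin

text \<open>Starting from an almost minimizer of f in S, finitely many polarizations produce a point u
  of S that is still an almost minimizer and is V-close to its symmetrization. Ekeland's variational
  principle at u yields a point \<xi> near u that is minimal for the Caristi order, on which F
  therefore has no choice but to be stationary; and \<xi> inherits the almost symmetry of u because
  symmetrization is V-Lipschitz.\<close>

lemma lower_semicontinuous_le_LIMSEQ:
  assumes "lower_semicontinuous f" "X \<longlonglongrightarrow> x" "(\<lambda>n. f (X n)) \<longlonglongrightarrow> L"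
  shows "f x \<le> L"
proof (rule ccontr)
  assume "\<not> f x \<le> L"
  then obtain a where a: "L < a" "a < f x"
    using dense by (metis not_le)
  have "\<forall>\<^sub>F y in nhds x. a < f y"
    using assms(1) a(2) unfolding lower_semicontinuous_def by blast
  then have "\<forall>\<^sub>F n in sequentially. a < f (X n)"
    using assms(2) by (rule eventually_compose_filterlim)
  then have "\<forall>\<^sub>F n in sequentially. a \<le> f (X n)"
    by (rule eventually_mono) simp
  then have "a \<le> L"
    using assms(3) by (intro tendsto_lowerbound) auto
  with a(1) show False by simp
qed

text \<open>Greedy descent in the Caristi order: each iterate nearly minimizes \<open>f\<close>
  among the points below its predecessor. The decrease of \<open>f\<close> controls the distances,
  so the iterates converge, and the sets of points below them shrink to the limit alone.\<close>

theorem Ekeland_variational_principle: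
  fixes f :: "'a::complete_space \<Rightarrow> real"
  assumes lsc: "lower_semicontinuous f" and bdd: "bdd_below (range f)"
  obtains \<xi> where "dist u \<xi> \<le> f u - f \<xi>" "\<And>y. dist \<xi> y \<le> f \<xi> - f y \<Longrightarrow> y = \<xi>"
proof -
  \<comment> \<open>\<open>T x\<close> is the set of points below \<open>x\<close> in the Caristi
    order; transitivity is the triangle inequality.\<close>
  define T where "T x = {y. dist x y \<le> f x - f y}" for x
  have T_refl: "x \<in> T x" for x by (simp add: T_def)
  have T_trans: "z \<in> T x" if "y \<in> T x" "z \<in> T y" for x y z
    using that dist_triangle[of x z y] by (simp add: T_def)
  have bddT: "bdd_below (f ` T x)" for x
    using bdd by (rule bdd_below_mono) auto
  \<comment> \<open>The infimum over \<open>T x\<close> need not be attained, hence a tolerance; all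
    that matters about \<open>(1/2)^n\<close> is that it is positive and tends to 0.\<close>
  define g where "g n x = (SOME y. y \<in> T x \<and> f y < Inf (f ` T x) + (1/2)^n)" for n :: nat and x
  have g: "g n x \<in> T x \<and> f (g n x) < Inf (f ` T x) + (1/2)^n" for n x
  proof -
    have "\<exists>z\<in>f ` T x. z < Inf (f ` T x) + (1/2)^n"
      using T_refl[of x] by (intro cInf_lessD) auto
    then have "\<exists>y. y \<in> T x \<and> f y < Inf (f ` T x) + (1/2)^n"
      by blast
    then show ?thesis
      unfolding g_def by (rule someI_ex)
  qed
  define X where "X = rec_nat u g"
  have X0: "X 0 = u" and XSuc: "\<And>n. X (Suc n) = g n (X n)"
    by (simp_all add: X_def)
  have XT: "X n \<in> T (X m)" if "m \<le> n" for m n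
    using that
  proof (induction n rule: dec_induct)
    case base
    show ?case by (rule T_refl)
  next
    case (step n)
    show ?case unfolding XSuc using T_trans[OF step.IH conjunct1[OF g]] .
  qed
  have dist_X: "dist (X m) (X n) \<le> f (X m) - f (X n)" if "m \<le> n" for m n
    using XT[OF that] by (simp add: T_def)
  have "decseq (\<lambda>n. f (X n))"
    unfolding decseq_def using dist_X by (metis diff_ge_0_iff_ge dual_order.trans zero_le_dist)
  moreover obtain B where B: "\<And>x. B \<le> f x"
    using bdd by (auto simp: bdd_below_def)
  ultimately obtain L where L: "(\<lambda>n. f (X n)) \<longlonglongrightarrow> L" and L_le: "\<And>n. L \<le> f (X n)"
    using decseq_convergent[of "\<lambda>n. f (X n)" B] by blast
  have "Cauchy X"
  proof (rule metric_CauchyI)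
    fix e :: real
    assume "0 < e"
    then obtain M where M: "\<And>n. n \<ge> M \<Longrightarrow> f (X n) < L + e"
      using order_tendstoD(2)[OF L, of "L + e"] by (auto simp: eventually_sequentially)
    \<comment> \<open>Both values of \<open>f\<close> lie between \<open>L\<close> and
      \<open>L + e\<close>, and their difference bounds the distance.\<close>
    have "dist (X m) (X n) < e" if "M \<le> m" "m \<le> n" for m n
      using dist_X[OF that(2)] M[OF that(1)] L_le[of n] by simp
    then show "\<exists>M. \<forall>m\<ge>M. \<forall>n\<ge>M. dist (X m) (X n) < e"
      by (metis dist_commute nle_le)
  qed
  then obtain \<xi> where \<xi>: "X \<longlonglongrightarrow> \<xi>"
    by (auto simp: Cauchy_convergent_iff convergent_def)
  have f\<xi>: "f \<xi> \<le> L"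
    using lsc \<xi> L by (rule lower_semicontinuous_le_LIMSEQ)
  have \<xi>T: "\<xi> \<in> T (X m)" for m
  proof -
    \<comment> \<open>Let \<open>n\<close> tend to infinity in \<open>dist_X\<close>; lower
      semicontinuity then allows \<open>L\<close> to be replaced by \<open>f \<xi>\<close>.\<close>
    have "dist (X m) \<xi> \<le> f (X m) - L"
    proof (rule LIMSEQ_le)
      show "(\<lambda>n. dist (X m) (X n)) \<longlonglongrightarrow> dist (X m) \<xi>"
        by (intro tendsto_intros \<xi>)
      show "(\<lambda>n. f (X m) - f (X n)) \<longlonglongrightarrow> f (X m) - L"
        by (intro tendsto_intros L)
    qed (use dist_X in blast)
    with f\<xi> show ?thesis by (simp add: T_def)
  qed
  show thesis
  proof
    show "dist u \<xi> \<le> f u - f \<xi>"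
      using \<xi>T[of 0] by (simp add: T_def X0)
    fix y
    assume "dist \<xi> y \<le> f \<xi> - f y"
    then have yT: "y \<in> T (X n)" for n
      using T_trans[OF \<xi>T] by (simp add: T_def)
    \<comment> \<open>The point \<open>y\<close> lies below \<open>X (Suc n)\<close>, so the
      distance is at most the drop of \<open>f\<close>. It also lies below \<open>X n\<close>, so
      \<open>f y\<close> is at least the infimum that \<open>X (Suc n)\<close> attains up to
      \<open>(1/2)^n\<close>.\<close>
    have bound: "dist (X (Suc n)) y \<le> (1/2)^n" for n
      using yT[of "Suc n"] conjunct2[OF g[of n "X n"]] cInf_lower[OF imageI[OF yT[of n]] bddT]
      unfolding T_def XSuc by simp
    have "(\<lambda>n. dist (X (Suc n)) y) \<longlonglongrightarrow> 0"
      by (rule tendsto_sandwich[OF _ _ tendsto_const LIMSEQ_power_zero[of "1/2::real"]])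
        (use bound in auto)
    then have "(\<lambda>n. X (Suc n)) \<longlonglongrightarrow> y"
      by (subst tendsto_dist_iff)
    then show "y = \<xi>"
      using \<xi> LIMSEQ_Suc LIMSEQ_unique by blast
  qed
qed

context symmetrization_framework
begin

text \<open>That polarization stays in \<open>S\<close> is encoded in the codomain
  \<open>top_of_set S\<close> of the continuous map.\<close>

lemma polarization_in_S:
  assumes "u \<in> S" "H \<in> topspace \<H>"
  shows "h u H \<in> S"
  using continuous_map_image_subset_topspace[OF polarization_continuous] assms by auto

lemma iterated_polarization:
  assumes "u \<in> S" "set Hs \<subseteq> topspace \<H>"
  shows "foldl h u Hs \<in> S" "star (foldl h u Hs) = star u"
  using assms
  by (induction Hs arbitrary: u) (auto simp: polarization_in_S star_polarization)

lemma iterated_polarization_le: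
  fixes f :: "'x \<Rightarrow> real"
  assumes "\<forall>u\<in>S. \<forall>H\<in>topspace \<H>. f (h u H) \<le> f u" "u \<in> S" "set Hs \<subseteq> topspace \<H>"
  shows "f (foldl h u Hs) \<le> f u"
  using assms(2,3)
proof (induction Hs arbitrary: u)
  case (Cons H Hs)
  then have "f (foldl h (h u H) Hs) \<le> f (h u H)" "f (h u H) \<le> f u"
    using assms(1) by (auto intro: polarization_in_S)
  then show ?case by simp
qed simp

lemma iterated_polarization_contractive:
  assumes "u \<in> S" "v \<in> S" "set Hs \<subseteq> topspace \<H>"
  shows "norm (i (foldl h u Hs) - i (foldl h v Hs)) \<le> norm (i u - i v)"
  using assms
proof (induction Hs arbitrary: u v)
  case (Cons H Hs)
  then have "norm (i (foldl h (h u H) Hs) - i (foldl h (h v H) Hs)) \<le> norm (i (h u H) - i (h v H))"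
    "norm (i (h u H) - i (h v H)) \<le> norm (i u - i v)"
    by (auto intro: polarization_in_S polarization_contractive)
  then show ?case by simp
qed simp

text \<open>One sequence of polarizers serves all points of \<open>S\<close>, so the contraction
  bound for its finite iterates at \<open>u\<close> and \<open>v\<close> passes to the
  limit.\<close>

lemma star_contractive:
  assumes "u \<in> S" "v \<in> S"
  shows "norm (i (star u) - i (star v)) \<le> norm (i u - i v)"
proof -
  obtain Hs where Hs: "\<And>m. Hs m \<in> topspace \<H>"
    and lim: "\<And>u. u \<in> S \<Longrightarrow> (\<lambda>m. i (foldl h u (map Hs [0..<m]))) \<longlonglongrightarrow> i (star u)"
    using approximation by blast
  show ?thesis
  proof (rule LIMSEQ_le_const2)
    show "(\<lambda>m. norm (i (foldl h u (map Hs [0..<m])) - i (foldl h v (map Hs [0..<m]))))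
        \<longlonglongrightarrow> norm (i (star u) - i (star v))"
      by (intro tendsto_intros lim assms)
    show "\<exists>N. \<forall>m\<ge>N. norm (i (foldl h u (map Hs [0..<m])) - i (foldl h v (map Hs [0..<m])))
        \<le> norm (i u - i v)"
      using assms Hs by (intro exI allI impI iterated_polarization_contractive) auto
  qed
qed

text \<open>Iterated polarizations of \<open>u\<close> approach \<open>star u\<close>, which is also
  their own symmetrization, while \<open>f\<close> never increases.\<close>

lemma exists_almost_symmetric_le:
  fixes f :: "'x \<Rightarrow> real"
  assumes "\<forall>u\<in>S. \<forall>H\<in>topspace \<H>. f (h u H) \<le> f u" "u \<in> S" "0 < e"
  obtains v where "v \<in> S" "f v \<le> f u" "norm (i v - i (star v)) < e"
proof -
  obtain Hs where Hs: "\<And>m. Hs m \<in> topspace \<H>"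
    and lim: "(\<lambda>m. i (foldl h u (map Hs [0..<m]))) \<longlonglongrightarrow> i (star u)"
    using approximation assms(2) by blast
  obtain m where "dist (i (foldl h u (map Hs [0..<m]))) (i (star u)) < e"
    using metric_LIMSEQ_D[OF lim assms(3)] by blast
  moreover have sub: "set (map Hs [0..<m]) \<subseteq> topspace \<H>"
    using Hs by auto
  ultimately show thesis
    using that iterated_polarization[OF assms(2) sub] iterated_polarization_le[OF assms(1,2) sub]
    by (metis dist_norm)
qed

end

theorem theorem3p4:
  fixes i :: "'x::banach \<Rightarrow> 'v::banach"
    and j :: "'v \<Rightarrow> 'w::banach"
    and S :: "'x set"
    and \<H> :: "'h topology"
    and h :: "'x \<Rightarrow> 'h \<Rightarrow> 'x"
    and star :: "'x \<Rightarrow> 'x"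
    and \<Theta> :: "'x \<Rightarrow> 'x"
    and F :: "'x \<Rightarrow> 'x"
    and f :: "'x \<Rightarrow> real"
  assumes "symmetrization_framework i j S \<H> h star \<Theta>"
    and "\<forall>u. norm (F u - u) \<le> f u - f (F u)"
    and "lower_semicontinuous f"
    and "bdd_below (range f)"
    and "\<forall>u\<in>S. \<forall>H\<in>topspace \<H>. f (h u H) \<le> f u"
    and "\<forall>u. \<exists>\<xi>\<in>S. f \<xi> \<le> f u"
  shows "\<forall>\<epsilon>::real. 0 < \<epsilon> \<and> \<epsilon> < 1 \<longrightarrow>
    (\<exists>\<xi>. F \<xi> = \<xi> \<and> norm (i \<xi> - i (extended_star star \<Theta> \<xi>)) < \<epsilon>)"
proof (intro allI impI)
  fix \<epsilon> :: real
  assume "0 < \<epsilon> \<and> \<epsilon> < 1"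
  then have \<epsilon>: "0 < \<epsilon>" by simp
  interpret symmetrization_framework i j S \<H> h star \<Theta> by fact
  obtain C where C: "C > 0" "\<And>u v. norm (i (\<Theta> u) - i (\<Theta> v)) \<le> C * norm (i u - i v)"
    using \<Theta>_lipschitz by blast
  obtain K where K: "K > 0" "\<And>x. norm (i x) \<le> norm x * K"
    using bounded_linear.pos_bounded[OF embedding_X_V(1)] by blast
  \<comment> \<open>Half of \<epsilon> is reserved for the asymmetry of \<open>u\<close>, half for
    moving from \<open>u\<close> to \<xi>. The move costs a factor 1 for the point and
    \<open>C\<close> for its symmetrization, and \<open>K\<close> converts the X-norm to the
    V-norm.\<close>
  define \<delta> where "\<delta> = \<epsilon> / (2 * (1 + C) * K)"
  have "1 + C > 0"
    using C(1) by simp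
  then have \<delta>: "\<delta> > 0" "(1 + C) * (\<delta> * K) = \<epsilon> / 2"
    using \<epsilon> K(1) by (simp_all add: \<delta>_def del: distrib_left_numeral)
  obtain w where w: "f w < Inf (range f) + \<delta>"
    using cInf_lessD[of "range f" "Inf (range f) + \<delta>"] \<delta>(1) by auto
  obtain v where "v \<in> S" "f v \<le> f w"
    using assms(6) by blast
  obtain u where u: "u \<in> S" "f u \<le> f v" "norm (i u - i (star u)) < \<epsilon> / 2"
    using exists_almost_symmetric_le[OF assms(5) \<open>v \<in> S\<close>, of "\<epsilon> / 2"] \<epsilon> by auto
  obtain \<xi> where near: "dist u \<xi> \<le> f u - f \<xi>"
    and minimal: "\<And>y. dist \<xi> y \<le> f \<xi> - f y \<Longrightarrow> y = \<xi>"
    using Ekeland_variational_principle[OF assms(3,4)] by blast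
  \<comment> \<open>The hypothesis on \<open>F\<close> puts \<open>F \<xi>\<close> below \<xi> in
    the Caristi order.\<close>
  have fixed: "F \<xi> = \<xi>"
    using minimal assms(2) by (simp add: dist_norm norm_minus_commute)
  \<comment> \<open>Since \<open>f u\<close> is within \<delta> of the infimum of \<open>f\<close>,
    the drop from \<open>f u\<close> to \<open>f \<xi>\<close> is at most \<delta>.\<close>
  have "norm (u - \<xi>) \<le> \<delta>"
    using near u(2) \<open>f v \<le> f w\<close> w cInf_lower[OF rangeI assms(4), of \<xi>] by (simp add: dist_norm)
  then have dV: "norm (i u - i \<xi>) \<le> \<delta> * K"
    using K(2)[of "u - \<xi>"] K(1) bounded_linear.linear[OF embedding_X_V(1)]
    by (metis linear_diff mult_right_mono less_imp_le order_trans)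
  \<comment> \<open>The point \<xi> may lie outside \<open>S\<close>, so contractivity is applied to
    \<open>\<Theta> \<xi>\<close>; as \<Theta> fixes \<open>u\<close>, its Lipschitz bound then
    leads back to \<xi>.\<close>
  have "norm (i (star u) - i (star (\<Theta> \<xi>))) \<le> norm (i u - i (\<Theta> \<xi>))"
    using u(1) \<Theta>_into by (intro star_contractive) auto
  also have "\<dots> \<le> C * norm (i u - i \<xi>)"
    using C(2)[of u \<xi>] \<Theta>_on_S[OF u(1)] by simp
  finally have "norm (i (star u) - i (star (\<Theta> \<xi>))) \<le> C * norm (i u - i \<xi>)" .
  moreover have "norm (i \<xi> - i (star (\<Theta> \<xi>)))
      \<le> norm (i u - i \<xi>) + norm (i u - i (star u)) + norm (i (star u) - i (star (\<Theta> \<xi>)))"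
    by norm
  moreover have "(1 + C) * norm (i u - i \<xi>) \<le> \<epsilon> / 2"
    unfolding \<delta>(2)[symmetric] using dV C(1) by (intro mult_left_mono) auto
  ultimately have "norm (i \<xi> - i (star (\<Theta> \<xi>))) < \<epsilon>"
    using u(3) by (simp add: algebra_simps)
  with fixed show "\<exists>\<xi>. F \<xi> = \<xi> \<and> norm (i \<xi> - i (extended_star star \<Theta> \<xi>)) < \<epsilon>"
    unfolding extended_star_def by blast
qed

end
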